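(* Let $x,y$ be real numbers with $y+1>0$ and $x+y>0$. If $x>1$, then $$\frac{[\Gamma(x+y+1)/\Gamma(y+1)]^{1/x}}{[\Gamma(x+y+2)/\Gamma(y+1)]^{1/(x+1)}}<\biggl(\frac{x+y}{x+y+1}\biggr)^{1/2},\qquad(\ast)$$ and if $x<1$, then the reversed strict inequality $$\frac{[\Gamma(x+y+1)/\Gamma(y+1)]^{1/x}}{[\Gamma(x+y+2)/\Gamma(y+1)]^{1/(x+1)}}>\biggl(\frac{x+y}{x+y+1}\biggr)^{1/2}\qquad(\ast\ast)$$ holds. Here the cases $x=0$ and $x=-1$ of $(\ast\ast)$ are understood by taking the limits as $x\to0$ and $x\to-1$ on both sides, that is, they are respectively the inequalities $$e^{\psi(y+1)}>(y+1)\biggl(\frac{y}{y+1}\biggr)^{1/2}\quad\text{for all } y>0,\qquad(\mathrm{A})$$ and $$e^{-\psi(y+1)}>\frac1y\biggl(\frac{y-1}{y}\biggr)^{1/2}\quad\text{for all } y>1.\qquad(\mathrm{B})$$ Moreover, the powers $\frac12$ are the best possible in the following sense: the power $\frac12$ in $(\ast)$ cannot be replaced by a larger number (for no $\alpha>\frac12$ does $(\ast)$ with $\frac12$ replaced by $\alpha$ hold for all $x>1$, $y>-1$ with $x+y>0$); and the powers $\frac12$ in $(\ast\ast)$, in (A), and in (B) cannot be replaced by a smaller number (for no $\alpha<\frac12$ does $(\ast\ast)$ with $\frac12$ replaced by $\alpha$ hold for all $x<1$, $y>-1$ with $x+y>0$; for no $\alpha<\frac12$ does (A) with $\frac12$ replaced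 by $\alpha$ hold for all $y>0$; for no $\alpha<\frac12$ does (B) with $\frac12$ replaced by $\alpha$ hold for all $y>1$).
   Context: $\Gamma$ denotes the Euler gamma function, $\Gamma(x)=\int_0^\infty t^{x-1}e^{-t}\,dt$ for real $x>0$, and $\psi(x)=\Gamma'(x)/\Gamma(x)$ is the digamma function. *)

theory Defs
  imports "HOL-Analysis.Analysis"
begin

text \<open>
  The left-hand side of the inequalities. Division by zero makes the value of this term
  meaningless at x = 0 and x = -1; at these two points the inequality is to be read through
  the limits in x.
\<close>

definition gamma_ratio :: "real \<Rightarrow> real \<Rightarrow> real" where
  "gamma_ratio x y =
     (Gamma (x + y + 1) / Gamma (y + 1)) powr (1 / x) /
     (Gamma (x + y + 2) / Gamma (y + 1)) powr (1 / (x + 1))"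

definition ratio_bound :: "real \<Rightarrow> real \<Rightarrow> real \<Rightarrow> real" where
  "ratio_bound \<alpha> x y = ((x + y) / (x + y + 1)) powr \<alpha>"

end

theory Submission
  imports Defs "HOL-Real_Asymp.Real_Asymp"
begin

text \<open>
  For fixed \<open>s = x + y\<close>, taking logarithms and multiplying by \<open>x (x + 1)\<close> turns the inequalities into
  statements about the sign of a function of \<open>x\<close> that vanishes at \<open>-1\<close>, \<open>0\<close>, \<open>1\<close> and whose third
  derivative is \<open>\<psi>'' (y + 1) < 0\<close>. By the error formula for quadratic interpolation its sign is opposite
  to that of \<open>x (x - 1) (x + 1)\<close>, and the signs of its derivatives at the nodes \<open>0\<close> and \<open>-1\<close> give the
  limiting inequalities. Equality at \<open>x = 1\<close> makes the power \<open>1/2\<close> optimal in the two main inequalities;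
  each limiting inequality gives the asymptotics of \<open>\<psi>\<close> that makes the power optimal in the other one.
\<close>

section \<open>Rolle's theorem, iterated on an interval\<close>

text \<open>The mean value theorem with equal end values. The zero is returned as a member of
  \<open>S\<close> so that the lemma applies again to \<open>f'\<close>.\<close>

lemma DERIV_zero_between_zeros:
  fixes f :: "real \<Rightarrow> real"
  assumes S: "is_interval S" and D: "\<And>x. x \<in> S \<Longrightarrow> DERIV f x :> f' x"
    and "a \<in> S" "b \<in> S" "a < b" "f a = 0" "f b = 0"
  obtains z where "a < z" "z < b" "z \<in> S" "f' z = 0"
proof -
  have sub: "x \<in> S" if "a \<le> x" "x \<le> b" for x
    using S assms that by (metis is_interval_1)
  obtain z where z: "a < z" "z < b" "f b - f a = (b - a) * f' z"
    using MVT2[of a b f f'] D sub \<open>a < b\<close> by blast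
  then show thesis
    using that[of z] assms sub by auto
qed

text \<open>Two rounds of Rolle. The count starts at the first derivative because a double zero of
  the original function supplies one of the three zeros of \<open>f1\<close> directly.\<close>

lemma third_deriv_zero:
  fixes f1 :: "real \<Rightarrow> real"
  assumes S: "is_interval S"
    and D2: "\<And>x. x \<in> S \<Longrightarrow> DERIV f1 x :> f2 x"
    and D3: "\<And>x. x \<in> S \<Longrightarrow> DERIV f2 x :> f3 x"
    and "a \<in> S" "b \<in> S" "c \<in> S" "a < b" "b < c" "f1 a = 0" "f1 b = 0" "f1 c = 0"
  obtains z where "z \<in> S" "f3 z = 0"
proof -
  obtain p where p: "a < p" "p < b" "p \<in> S" "f2 p = 0"
    using DERIV_zero_between_zeros[OF S D2, where a = a and b = b] assms by blast
  obtain q where q: "b < q" "q < c" "q \<in> S" "f2 q = 0"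
    using DERIV_zero_between_zeros[OF S D2, where a = b and b = c] assms by blast
  have "p < q" using p q by simp
  then show thesis
    using DERIV_zero_between_zeros[OF S D3, where a = p and b = q] p q that by blast
qed

lemma third_deriv_zero_if_four_zeros:
  fixes f :: "real \<Rightarrow> real"
  assumes S: "is_interval S"
    and D1: "\<And>x. x \<in> S \<Longrightarrow> DERIV f x :> f1 x"
    and D2: "\<And>x. x \<in> S \<Longrightarrow> DERIV f1 x :> f2 x"
    and D3: "\<And>x. x \<in> S \<Longrightarrow> DERIV f2 x :> f3 x"
    and "a \<in> S" "b \<in> S" "c \<in> S" "d \<in> S" "a < b" "b < c" "c < d"
    and "f a = 0" "f b = 0" "f c = 0" "f d = 0"
  obtains z where "z \<in> S" "f3 z = 0"
proof -
  obtain p where p: "a < p" "p < b" "p \<in> S" "f1 p = 0"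
    using DERIV_zero_between_zeros[OF S D1, where a = a and b = b] assms by blast
  obtain q where q: "b < q" "q < c" "q \<in> S" "f1 q = 0"
    using DERIV_zero_between_zeros[OF S D1, where a = b and b = c] assms by blast
  obtain r where r: "c < r" "r < d" "r \<in> S" "f1 r = 0"
    using DERIV_zero_between_zeros[OF S D1, where a = c and b = d] assms by blast
  have "p < q" "q < r" using p q r by simp_all
  then show thesis
    using third_deriv_zero[OF S D2 D3, where a = p and b = q and c = r] p q r that by blast
qed

section \<open>Quadratic interpolation at the nodes -1, 0, 1\<close>

text \<open>The quadratic interpolating \<open>f\<close> at the nodes is zero, so \<open>f\<close>
  is its own interpolation error: the node polynomial \<open>x ^ 3 - x\<close> times a sixth of some
  value of \<open>f3\<close>. \<open>S\<close> is a general interval because the application lives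
  on a half-line.\<close>

locale neg_third_deriv_nodes =
  fixes S :: "real set" and f f1 f2 f3 :: "real \<Rightarrow> real"
  assumes S: "is_interval S" "-1 \<in> S" "0 \<in> S" "1 \<in> S"
    and D1: "\<And>x. x \<in> S \<Longrightarrow> DERIV f x :> f1 x"
    and D2: "\<And>x. x \<in> S \<Longrightarrow> DERIV f1 x :> f2 x"
    and D3: "\<And>x. x \<in> S \<Longrightarrow> DERIV f2 x :> f3 x"
    and neg: "\<And>x. x \<in> S \<Longrightarrow> f3 x < 0"
    and nodes: "f (-1) = 0" "f 0 = 0" "f 1 = 0"
begin

text \<open>
  Off the nodes, \<open>c\<close> is chosen so that the error has a fourth zero; at a node, so that it has a double zero.
  Repeated use of Rolle's theorem then produces a zero of \<open>f3 - 6 c\<close>, which forces \<open>c < 0\<close>.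
\<close>

definition err where "err c x = f x - c * (x ^ 3 - x)"
definition err1 where "err1 c x = f1 x - c * (3 * x ^ 2 - 1)"
definition err2 where "err2 c x = f2 x - c * (6 * x)"
definition err3 where "err3 c x = f3 x - c * 6"

lemma DERIV_err:
  assumes "x \<in> S"
  shows "DERIV (err c) x :> err1 c x" "DERIV (err1 c) x :> err2 c x" "DERIV (err2 c) x :> err3 c x"
  unfolding err_def [abs_def] err1_def [abs_def] err2_def [abs_def] err3_def
  by (rule derivative_eq_intros D1 D2 D3 assms refl | simp)+

lemma err_nodes: "err c (-1) = 0" "err c 0 = 0" "err c 1 = 0"
  by (simp_all add: err_def nodes)

lemma err3_zero_imp_neg: "z \<in> S \<Longrightarrow> err3 c z = 0 \<Longrightarrow> c < 0"
  using neg[of z] by (simp add: err3_def)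

lemma sign_off_nodes:
  assumes x: "x \<in> S" "x \<noteq> -1" "x \<noteq> 0" "x \<noteq> 1"
  shows "f x / (x ^ 3 - x) < 0"
proof -
  have w: "x ^ 3 - x \<noteq> 0"
  proof -
    have "x ^ 3 - x = x * (x - 1) * (x + 1)" by (simp add: power3_eq_cube algebra_simps)
    then show ?thesis using x by auto
  qed
  define c where "c = f x / (x ^ 3 - x)"
  have ex: "err c x = 0" using w by (simp add: err_def c_def)
  note zeros = third_deriv_zero_if_four_zeros[OF S(1) DERIV_err[where c = c]]
  consider "x < -1" | "-1 < x" "x < 0" | "0 < x" "x < 1" | "1 < x"
    using x by linarith
  \<comment> \<open>The position of \<open>x\<close> among the nodes only decides the order in which
    the four zeros enter Rolle's theorem.\<close>
  then have "\<exists>z \<in> S. err3 c z = 0"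
  proof cases
    case 1
    show ?thesis
      by (rule zeros[where a = x and b = "-1" and c = 0 and d = 1]) (use 1 x(1) S ex err_nodes in auto)
  next
    case 2
    show ?thesis
      by (rule zeros[where a = "-1" and b = x and c = 0 and d = 1]) (use 2 x(1) S ex err_nodes in auto)
  next
    case 3
    show ?thesis
      by (rule zeros[where a = "-1" and b = 0 and c = x and d = 1]) (use 3 x(1) S ex err_nodes in auto)
  next
    case 4
    show ?thesis
      by (rule zeros[where a = "-1" and b = 0 and c = 1 and d = x]) (use 4 x(1) S ex err_nodes in auto)
  qed
  then show ?thesis using err3_zero_imp_neg c_def by blast
qed

lemma sign_deriv_nodes: "f1 0 > 0" "f1 (-1) < 0"
proof -
  \<comment> \<open>For every \<open>c\<close> the nodes force two zeros of \<open>err1 c\<close>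
    strictly between them; a suitable \<open>c\<close> adds a third at a node.\<close>
  have inner: "\<exists>p q. -1 < p \<and> p < 0 \<and> 0 < q \<and> q < 1 \<and> p \<in> S \<and> q \<in> S \<and> err1 c p = 0 \<and> err1 c q = 0" for c
  proof -
    obtain p where "-1 < p" "p < 0" "p \<in> S" "err1 c p = 0"
      using DERIV_zero_between_zeros[OF S(1) DERIV_err(1), where a = "-1" and b = 0] S err_nodes by auto
    moreover obtain q where "0 < q" "q < 1" "q \<in> S" "err1 c q = 0"
      using DERIV_zero_between_zeros[OF S(1) DERIV_err(1), where a = 0 and b = 1] S err_nodes by auto
    ultimately show ?thesis by blast
  qed
  \<comment> \<open>The slope of \<open>x ^ 3 - x\<close> at 0 is -1, so \<open>c = - f1 0\<close>
    cancels the slope of \<open>f\<close> there, and \<open>c < 0\<close> means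
    \<open>f1 0 > 0\<close>.\<close>
  have "err1 (- f1 0) 0 = 0" by (simp add: err1_def)
  moreover obtain p q where "-1 < p" "p < 0" "0 < q" "p \<in> S" "q \<in> S"
      "err1 (- f1 0) p = 0" "err1 (- f1 0) q = 0"
    using inner[of "- f1 0"] by blast
  ultimately obtain z where "z \<in> S" "err3 (- f1 0) z = 0"
    using third_deriv_zero[OF S(1) DERIV_err(2,3), of p 0 q] S by blast
  then show "f1 0 > 0" using err3_zero_imp_neg by fastforce
  \<comment> \<open>At -1 the slope of \<open>x ^ 3 - x\<close> is 2, hence the half.\<close>
  have "err1 (f1 (-1) / 2) (-1) = 0" by (simp add: err1_def)
  moreover obtain p q where "-1 < p" "p < 0" "0 < q" "p \<in> S" "q \<in> S"
      "err1 (f1 (-1) / 2) p = 0" "err1 (f1 (-1) / 2) q = 0"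
    using inner[of "f1 (-1) / 2"] by blast
  moreover from this have "p < q" by simp
  ultimately obtain z where "z \<in> S" "err3 (f1 (-1) / 2) z = 0"
    using third_deriv_zero[OF S(1) DERIV_err(2,3), of "-1" p q] S by blast
  then show "f1 (-1) < 0" using err3_zero_imp_neg by fastforce
qed

end

section \<open>The logarithm of the quotient of the two sides, for fixed
  \<open>x + y\<close>\<close>

text \<open>With \<open>y = s - x\<close> this is \<open>x * (x + 1)\<close> times the logarithm of
  \<open>gamma_ratio x y / ratio_bound (1/2) x y\<close>. The factor clears the denominators, so the
  function is smooth through 0 and -1.\<close>

definition log_gap :: "real \<Rightarrow> real \<Rightarrow> real" where
  "log_gap s x = ln_Gamma (s + 1) - ln_Gamma (s + 1 - x) - x * ln (s + 1)
     + x * (x + 1) / 2 * (ln (s + 1) - ln s)"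

lemma ln_Gamma_real_plus1:
  assumes "(x :: real) > 0"
  shows "ln_Gamma (x + 1) = ln x + ln_Gamma x"
proof -
  have "Gamma (x + 1) = x * Gamma x"
    using assms by (intro Gamma_plus1) auto
  then show ?thesis
    using assms Gamma_real_pos[of x] by (simp add: ln_Gamma_real_pos ln_mult_pos)
qed

text \<open>The zeros at -1 and 1 come from the functional equation of \<open>Gamma\<close>. Apart
  from a quadratic in \<open>x\<close>, only \<open>- ln_Gamma (s + 1 - x)\<close> survives, which
  gives the third derivative; \<open>s > 0\<close> puts the node 1 into the half-line.\<close>

lemma log_gap_nodes:
  assumes "s > 0"
  shows "neg_third_deriv_nodes {..<s + 1} (log_gap s)
    (\<lambda>x. Digamma (s + 1 - x) - ln (s + 1) + (x + 1 / 2) * (ln (s + 1) - ln s))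
    (\<lambda>x. - Polygamma 1 (s + 1 - x) + (ln (s + 1) - ln s))
    (\<lambda>x. Polygamma 2 (s + 1 - x))"
proof
  fix x assume "x \<in> {..<s + 1}"
  then have x: "s + 1 - x > 0" "s + 1 - x \<notin> \<int>\<^sub>\<le>\<^sub>0" by (auto elim!: nonpos_Ints_cases)
  show "DERIV (log_gap s) x :>
      Digamma (s + 1 - x) - ln (s + 1) + (x + 1 / 2) * (ln (s + 1) - ln s)"
    unfolding log_gap_def [abs_def] using x
    by (auto intro!: derivative_eq_intros simp: field_simps)
  show "((\<lambda>x. Digamma (s + 1 - x) - ln (s + 1) + (x + 1 / 2) * (ln (s + 1) - ln s))
      has_real_derivative - Polygamma 1 (s + 1 - x) + (ln (s + 1) - ln s)) (at x)"
    using x by (auto intro!: derivative_eq_intros)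
  show "((\<lambda>x. - Polygamma 1 (s + 1 - x) + (ln (s + 1) - ln s))
      has_real_derivative Polygamma 2 (s + 1 - x)) (at x)"
    using x by (auto intro!: derivative_eq_intros simp: numeral_2_eq_2)
  show "Polygamma 2 (s + 1 - x) < 0"
    using x by (intro Polygamma_real_even_neg) auto
next
  show "log_gap s (- 1) = 0"
    using assms ln_Gamma_real_plus1[of "s + 1"] by (simp add: log_gap_def)
  show "log_gap s 1 = 0"
    using assms ln_Gamma_real_plus1[of s] by (simp add: log_gap_def)
qed (use assms in \<open>auto simp: log_gap_def\<close>)

text \<open>The slope of \<open>log_gap y\<close> at the node 0; logarithmic form of the limiting
  inequality at \<open>x = 0\<close>.\<close>

lemma Digamma_gt_ln:
  assumes "(y :: real) > 0"
  shows "Digamma (y + 1) > ln (y + 1) + (ln y - ln (y + 1)) / 2"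
  using neg_third_deriv_nodes.sign_deriv_nodes(1)[OF log_gap_nodes[OF assms]]
  by (simp add: field_simps)

text \<open>The slope at the node -1. There \<open>x + y\<close> is \<open>y - 1\<close>, which must
  be positive.\<close>

lemma Digamma_lt_ln:
  assumes "(y :: real) > 1"
  shows "Digamma (y + 1) < ln y + (ln y - ln (y - 1)) / 2"
  using neg_third_deriv_nodes.sign_deriv_nodes(2)[OF log_gap_nodes[of "y - 1"]] assms
  by (simp add: field_simps)

section \<open>The two main inequalities\<close>

text \<open>The identity persists at \<open>x = 0\<close> and \<open>x = -1\<close>: division by
  zero gives 0, so the affected power and the matching exponential are both 1.\<close>

lemma gamma_ratio_eq_exp:
  assumes "y + 1 > 0" "x + y + 1 > 0"
  shows "gamma_ratio x y = exp ((ln_Gamma (x + y + 1) - ln_Gamma (y + 1)) / x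
    - (ln_Gamma (x + y + 2) - ln_Gamma (y + 1)) / (x + 1))"
proof -
  have "Gamma (x + y + 1) \<noteq> 0" "Gamma (x + y + 2) \<noteq> 0" "Gamma (y + 1) \<noteq> 0"
    using assms by (intro less_imp_neq[symmetric] Gamma_real_pos; simp)+
  then show ?thesis
    using assms by (simp add: gamma_ratio_def powr_def ln_div exp_diff ln_Gamma_real_pos)
qed

lemma ratio_bound_eq_exp:
  assumes "x + y > 0"
  shows "ratio_bound \<alpha> x y = exp (\<alpha> * (ln (x + y) - ln (x + y + 1)))"
  using assms by (simp add: ratio_bound_def powr_def ln_div)

lemma gamma_ratio_eq_ratio_bound:
  assumes "y + 1 > 0" "x + y > 0" "x \<noteq> 0" "x \<noteq> -1"
  shows "gamma_ratio x y = ratio_bound (1/2) x y * exp (log_gap (x + y) x / (x * (x + 1)))"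
proof -
  define s where "s = x + y"
  have "x + 1 \<noteq> 0" using assms by linarith
  \<comment> \<open>\<open>A\<close>, \<open>l\<close>, \<open>k\<close> stand for
    \<open>ln_Gamma (s + 1) - ln_Gamma (y + 1)\<close>, \<open>ln (s + 1)\<close> and
    \<open>ln s\<close>. The left side is \<open>(A - x * l) / (x * (x + 1))\<close>; the logarithm
    of the bound is then added and subtracted.\<close>
  then have partial_fractions: "A / x - (l + A) / (x + 1)
      = 1 / 2 * (k - l) + (A - x * l + x * (x + 1) / 2 * (l - k)) / (x * (x + 1))" for A l k :: real
    using assms(3) by (simp add: divide_simps) (simp add: algebra_simps)
  have "ln_Gamma (s + 2) = ln (s + 1) + ln_Gamma (s + 1)"
    using ln_Gamma_real_plus1[of "s + 1"] assms by (simp add: s_def add.assoc)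
  moreover have "ln_Gamma (s + 1 - x) = ln_Gamma (y + 1)" by (simp add: s_def)
  ultimately have "(ln_Gamma (s + 1) - ln_Gamma (y + 1)) / x
      - (ln_Gamma (s + 2) - ln_Gamma (y + 1)) / (x + 1)
    = 1 / 2 * (ln s - ln (s + 1)) + log_gap s x / (x * (x + 1))"
    using partial_fractions[of "ln_Gamma (s + 1) - ln_Gamma (y + 1)" "ln (s + 1)" "ln s"]
    by (simp add: log_gap_def algebra_simps)
  then show ?thesis
    using assms by (simp add: gamma_ratio_eq_exp ratio_bound_eq_exp s_def exp_add [symmetric])
qed

text \<open>Dividing by \<open>x * (x + 1)\<close> instead of the cubic leaves a factor
  \<open>x - 1\<close>, so the sign changes at 1 but not at 0 or -1.\<close>

lemma log_gap_quotient_sign: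
  assumes "s > 0" "x < s + 1" "x \<noteq> -1" "x \<noteq> 0" "x \<noteq> 1"
  shows "log_gap s x / (x * (x + 1)) < 0 \<longleftrightarrow> x > 1"
    and "log_gap s x / (x * (x + 1)) > 0 \<longleftrightarrow> x < 1"
proof -
  have "log_gap s x / (x ^ 3 - x) < 0"
    using assms by (intro neg_third_deriv_nodes.sign_off_nodes[OF log_gap_nodes]) auto
  moreover have "x ^ 3 - x = (x * (x + 1)) * (x - 1)"
    by (simp add: power3_eq_cube algebra_simps)
  then have "log_gap s x / (x * (x + 1)) = log_gap s x / (x ^ 3 - x) * (x - 1)"
    using assms by simp
  ultimately show "log_gap s x / (x * (x + 1)) < 0 \<longleftrightarrow> x > 1"
    and "log_gap s x / (x * (x + 1)) > 0 \<longleftrightarrow> x < 1"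
    by (simp_all add: mult_less_0_iff zero_less_mult_iff del: times_divide_eq_left)
qed

lemma gamma_ratio_less_ratio_bound:
  assumes "y + 1 > 0" "x + y > 0" "x > 1"
  shows "gamma_ratio x y < ratio_bound (1/2) x y"
  using log_gap_quotient_sign(1)[of "x + y" x] assms
  by (simp add: gamma_ratio_eq_ratio_bound ratio_bound_eq_exp)

lemma gamma_ratio_greater_ratio_bound:
  assumes "y + 1 > 0" "x + y > 0" "x < 1" "x \<noteq> 0" "x \<noteq> -1"
  shows "gamma_ratio x y > ratio_bound (1/2) x y"
  using log_gap_quotient_sign(2)[of "x + y" x] assms
  by (simp add: gamma_ratio_eq_ratio_bound ratio_bound_eq_exp)

section \<open>The limits at \<open>x = 0\<close> and \<open>x = -1\<close>\<close>

lemma tendsto_ln_Gamma_quotient: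
  assumes "(y :: real) + 1 > 0"
  shows "((\<lambda>h. (ln_Gamma (y + 1 + h) - ln_Gamma (y + 1)) / h) \<longlongrightarrow> Digamma (y + 1)) (at 0)"
  using has_field_derivative_ln_Gamma_real[OF assms] by (simp add: DERIV_def)

text \<open>In the exponent the first term is a difference quotient of \<open>ln_Gamma\<close> at
  \<open>y + 1\<close>, while the second is continuous at 0 with value
  \<open>ln (y + 1)\<close>.\<close>

lemma gamma_ratio_tendsto_at_0:
  assumes "y > 0"
  shows "((\<lambda>x. gamma_ratio x y) \<longlongrightarrow> exp (Digamma (y + 1)) / (y + 1)) (at 0)"
proof -
  have "isCont (\<lambda>x. (ln_Gamma (x + y + 2) - ln_Gamma (y + 1)) / (x + 1)) 0"
    using assms by (intro DERIV_isCont derivative_eq_intros | simp)+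
  then have "((\<lambda>x. (ln_Gamma (x + y + 2) - ln_Gamma (y + 1)) / (x + 1)) \<longlongrightarrow> ln (y + 1)) (at 0)"
    using ln_Gamma_real_plus1[of "y + 1"] assms by (simp add: isCont_def add.assoc)
  with tendsto_ln_Gamma_quotient[of y] assms
  have "((\<lambda>x. exp ((ln_Gamma (x + y + 1) - ln_Gamma (y + 1)) / x
      - (ln_Gamma (x + y + 2) - ln_Gamma (y + 1)) / (x + 1)))
    \<longlongrightarrow> exp (Digamma (y + 1) - ln (y + 1))) (at 0)"
    by (intro tendsto_intros) (simp_all add: add_ac)
  moreover have "\<forall>\<^sub>F x in at 0. x + y + 1 > 0"
    using assms by (intro order_tendstoD(1)[where y = "0 + y + 1"] tendsto_intros) auto
  ultimately have "((\<lambda>x. gamma_ratio x y) \<longlongrightarrow> exp (Digamma (y + 1) - ln (y + 1))) (at 0)"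
    by (elim Lim_transform_eventually) (use assms in \<open>auto elim!: eventually_mono simp: gamma_ratio_eq_exp\<close>)
  then show ?thesis using assms by (simp add: exp_diff)
qed

text \<open>The roles are exchanged: the first term is continuous with value \<open>ln y\<close>,
  and the second is a difference quotient in \<open>h = x + 1\<close>.\<close>

lemma gamma_ratio_tendsto_at_minus_1:
  assumes "y > 1"
  shows "((\<lambda>x. gamma_ratio x y) \<longlongrightarrow> y * exp (- Digamma (y + 1))) (at (-1))"
proof -
  have "isCont (\<lambda>x. (ln_Gamma (x + y + 1) - ln_Gamma (y + 1)) / x) (-1)"
    using assms by (intro DERIV_isCont derivative_eq_intros | simp)+
  then have "((\<lambda>x. (ln_Gamma (x + y + 1) - ln_Gamma (y + 1)) / x) \<longlongrightarrow> ln y) (at (-1))"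
    using ln_Gamma_real_plus1[of y] assms by (simp add: isCont_def)
  moreover have "((\<lambda>x. (ln_Gamma (x + y + 2) - ln_Gamma (y + 1)) / (x + 1)) \<longlongrightarrow> Digamma (y + 1)) (at (-1))"
    using tendsto_ln_Gamma_quotient[of y] assms by (subst LIM_offset_zero_iff) (simp_all add: add_ac)
  ultimately have "((\<lambda>x. exp ((ln_Gamma (x + y + 1) - ln_Gamma (y + 1)) / x
      - (ln_Gamma (x + y + 2) - ln_Gamma (y + 1)) / (x + 1)))
    \<longlongrightarrow> exp (ln y - Digamma (y + 1))) (at (-1))"
    by (intro tendsto_intros)
  moreover have "\<forall>\<^sub>F x in at (-1). x + y + 1 > 0"
    using assms by (intro order_tendstoD(1)[where y = "-1 + y + 1"] tendsto_intros) auto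
  ultimately have "((\<lambda>x. gamma_ratio x y) \<longlongrightarrow> exp (ln y - Digamma (y + 1))) (at (-1))"
    by (elim Lim_transform_eventually) (use assms in \<open>auto elim!: eventually_mono simp: gamma_ratio_eq_exp\<close>)
  then show ?thesis using assms by (simp add: exp_diff exp_minus field_simps)
qed

section \<open>Continuity in \<open>x\<close> and optimality of the powers\<close>

lemma ratio_bound_isCont:
  assumes "x + y > 0"
  shows "isCont (\<lambda>x. ratio_bound \<alpha> x y) x"
  unfolding ratio_bound_def using assms by (intro continuous_intros) auto

lemma gamma_ratio_isCont:
  assumes "y + 1 > 0" "x > 0" "x + y > 0"
  shows "isCont (\<lambda>x. gamma_ratio x y) x"
proof -
  have "isCont (\<lambda>x. exp ((ln_Gamma (x + y + 1) - ln_Gamma (y + 1)) / x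
      - (ln_Gamma (x + y + 2) - ln_Gamma (y + 1)) / (x + 1))) x"
    using assms by (intro DERIV_isCont derivative_eq_intros | simp)+
  moreover have "\<forall>\<^sub>F u in nhds x. u + y + 1 > 0"
    using assms by (intro order_tendstoD(1)[where y = "x + y + 1"] tendsto_intros filterlim_ident) auto
  then have "\<forall>\<^sub>F u in nhds x. gamma_ratio u y = exp ((ln_Gamma (u + y + 1) - ln_Gamma (y + 1)) / u
      - (ln_Gamma (u + y + 2) - ln_Gamma (y + 1)) / (u + 1))"
    using assms by (auto elim!: eventually_mono simp: gamma_ratio_eq_exp)
  ultimately show ?thesis by (simp add: isCont_cong)
qed

text \<open>Equality comes from the node 1 with \<open>s = 1\<close>.\<close>

lemma gamma_ratio_1: "gamma_ratio 1 0 = ratio_bound (1/2) 1 0"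
  using neg_third_deriv_nodes.nodes(3)[OF log_gap_nodes[of 1]]
  by (simp add: gamma_ratio_eq_ratio_bound)

lemma exp_Digamma_gt_iff:
  assumes "(y :: real) > 0"
  shows "exp (Digamma (y + 1)) > (y + 1) * (y / (y + 1)) powr \<alpha> \<longleftrightarrow>
    Digamma (y + 1) > ln (y + 1) + \<alpha> * (ln y - ln (y + 1))"
proof -
  have "(y + 1) * (y / (y + 1)) powr \<alpha> = exp (ln (y + 1) + \<alpha> * (ln y - ln (y + 1)))"
    using assms by (simp add: powr_def ln_div exp_add)
  then show ?thesis by simp
qed

lemma exp_minus_Digamma_gt_iff:
  assumes "(y :: real) > 1"
  shows "exp (- Digamma (y + 1)) > 1 / y * ((y - 1) / y) powr \<alpha> \<longleftrightarrow>
    Digamma (y + 1) < ln y + \<alpha> * (ln y - ln (y - 1))"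
proof -
  have "1 / y * ((y - 1) / y) powr \<alpha> = exp (- ln y + \<alpha> * (ln (y - 1) - ln y))"
    using assms by (simp add: powr_def ln_div exp_diff exp_minus exp_add divide_simps)
  then show ?thesis by (simp add: algebra_simps)
qed

text \<open>The assumed lower bound must stay below the upper bound \<open>Digamma_lt_ln\<close>.
  Both differ from \<open>ln y\<close> by terms of order \<open>1 / y\<close>, so multiplying by
  \<open>y\<close> and letting \<open>y\<close> grow compares the coefficients.\<close>

lemma power_optimal_Digamma_gt:
  assumes "\<And>y :: real. y > 0 \<Longrightarrow> Digamma (y + 1) > ln (y + 1) + \<alpha> * (ln y - ln (y + 1))"
  shows "\<alpha> \<ge> 1 / 2"
proof -
  have "\<forall>\<^sub>F y :: real in at_top. y * (ln (y + 1) + \<alpha> * (ln y - ln (y + 1)))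
      \<le> y * (ln y + (ln y - ln (y - 1)) / 2)"
    using eventually_gt_at_top[of 1]
  proof eventually_elim
    case (elim y)
    then show ?case
      using assms[of y] Digamma_lt_ln[of y] by (intro mult_left_mono) auto
  qed
  then have "\<forall>\<^sub>F y :: real in at_top. \<alpha> * (y * (ln y - ln (y + 1)))
      \<le> y * (ln y - ln (y + 1)) + y * (ln y - ln (y - 1)) / 2"
    by eventually_elim (simp add: algebra_simps)
  moreover have "((\<lambda>y :: real. y * (ln y - ln (y + 1))) \<longlongrightarrow> -1) at_top"
    by real_asymp
  then have "((\<lambda>y :: real. \<alpha> * (y * (ln y - ln (y + 1)))) \<longlongrightarrow> \<alpha> * (-1)) at_top"
    by (intro tendsto_intros)
  \<comment> \<open>The two summands tend to -1 and 1/2.\<close>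
  moreover have "((\<lambda>y :: real. y * (ln y - ln (y + 1)) + y * (ln y - ln (y - 1)) / 2) \<longlongrightarrow> -1/2) at_top"
    by real_asymp
  ultimately have "\<alpha> * (-1) \<le> -1/2"
    by (intro tendsto_le[OF trivial_limit_at_top_linorder])
  then show ?thesis by simp
qed

text \<open>The mirror image: here \<open>Digamma_gt_ln\<close> is the known bound that the assumed
  one must not cross.\<close>

lemma power_optimal_Digamma_lt:
  assumes "\<And>y :: real. y > 1 \<Longrightarrow> Digamma (y + 1) < ln y + \<alpha> * (ln y - ln (y - 1))"
  shows "\<alpha> \<ge> 1 / 2"
proof -
  have "\<forall>\<^sub>F y :: real in at_top. y * (ln (y + 1) + (ln y - ln (y + 1)) / 2)
      \<le> y * (ln y + \<alpha> * (ln y - ln (y - 1)))"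
    using eventually_gt_at_top[of 1]
  proof eventually_elim
    case (elim y)
    then show ?case
      using assms[of y] Digamma_gt_ln[of y] by (intro mult_left_mono) auto
  qed
  then have "\<forall>\<^sub>F y :: real in at_top. y * (ln (y + 1) - ln y) / 2
      \<le> \<alpha> * (y * (ln y - ln (y - 1)))"
    by eventually_elim (simp add: field_simps)
  moreover have "((\<lambda>y :: real. y * (ln y - ln (y - 1))) \<longlongrightarrow> 1) at_top"
    by real_asymp
  then have "((\<lambda>y :: real. \<alpha> * (y * (ln y - ln (y - 1)))) \<longlongrightarrow> \<alpha> * 1) at_top"
    by (intro tendsto_intros)
  moreover have "((\<lambda>y :: real. y * (ln (y + 1) - ln y) / 2) \<longlongrightarrow> 1/2) at_top"
    by real_asymp
  ultimately have "1/2 \<le> \<alpha> * 1"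
    by (intro tendsto_le[OF trivial_limit_at_top_linorder])
  then show ?thesis by simp
qed

text \<open>Let \<open>x\<close> decrease to 1 with \<open>y = 0\<close>. The limits are the powers
  1/2 and \<alpha> of the base 1/2, and since the base is below 1 a larger exponent would reverse
  their order.\<close>

lemma power_optimal_right_of_1:
  assumes "\<And>x. x > 1 \<Longrightarrow> gamma_ratio x 0 < ratio_bound \<alpha> x 0"
  shows "\<alpha> \<le> 1 / 2"
proof -
  have "((\<lambda>x. gamma_ratio x 0) \<longlongrightarrow> gamma_ratio 1 0) (at_right 1)"
       "((\<lambda>x. ratio_bound \<alpha> x 0) \<longlongrightarrow> ratio_bound \<alpha> 1 0) (at_right 1)"
    using gamma_ratio_isCont[of 0 1] ratio_bound_isCont[of 1 0 \<alpha>]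
    by (simp_all add: isCont_def filterlim_at_split)
  moreover have "\<forall>\<^sub>F x in at_right 1. gamma_ratio x 0 \<le> ratio_bound \<alpha> x 0"
    using assms by (auto simp: eventually_at_filter intro!: always_eventually less_imp_le)
  ultimately have "gamma_ratio 1 0 \<le> ratio_bound \<alpha> 1 0"
    by (intro tendsto_le[of "at_right (1 :: real)"]) auto
  then show ?thesis
    by (simp add: gamma_ratio_1 ratio_bound_eq_exp)
qed

lemma power_optimal_left_of_1:
  assumes "\<And>x. 0 < x \<Longrightarrow> x < 1 \<Longrightarrow> gamma_ratio x 0 > ratio_bound \<alpha> x 0"
  shows "\<alpha> \<ge> 1 / 2"
proof -
  have "((\<lambda>x. gamma_ratio x 0) \<longlongrightarrow> gamma_ratio 1 0) (at_left 1)"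
       "((\<lambda>x. ratio_bound \<alpha> x 0) \<longlongrightarrow> ratio_bound \<alpha> 1 0) (at_left 1)"
    using gamma_ratio_isCont[of 0 1] ratio_bound_isCont[of 1 0 \<alpha>]
    by (simp_all add: isCont_def filterlim_at_split)
  \<comment> \<open>Approaching 1 inside \<open>0 < x < 1\<close> avoids the singular points 0 and
    -1.\<close>
  moreover have "\<forall>\<^sub>F x :: real in at_left 1. 0 < x \<and> x < 1"
    by (rule eventually_at_leftI[of 0]) auto
  then have "\<forall>\<^sub>F x in at_left 1. gamma_ratio x 0 \<ge> ratio_bound \<alpha> x 0"
    by eventually_elim (use assms in \<open>auto intro: less_imp_le\<close>)
  ultimately have "gamma_ratio 1 0 \<ge> ratio_bound \<alpha> 1 0"
    by (intro tendsto_le[of "at_left (1 :: real)"]) auto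
  then show ?thesis
    by (simp add: gamma_ratio_1 ratio_bound_eq_exp)
qed

theorem theorem1p1:
  shows
    "(\<forall>x y :: real. y + 1 > 0 \<and> x + y > 0 \<and> x > 1 \<longrightarrow>
        gamma_ratio x y < ratio_bound (1/2) x y)
   \<and> (\<forall>x y :: real. y + 1 > 0 \<and> x + y > 0 \<and> x < 1 \<and> x \<noteq> 0 \<and> x \<noteq> -1 \<longrightarrow>
        gamma_ratio x y > ratio_bound (1/2) x y)
   \<and> (\<forall>y :: real. y > 0 \<longrightarrow>
        ((\<lambda>x. gamma_ratio x y) \<longlongrightarrow> exp (Digamma (y + 1)) / (y + 1)) (at 0) \<and>
        ((\<lambda>x. ratio_bound (1/2) x y) \<longlongrightarrow> (y / (y + 1)) powr (1/2)) (at 0) \<and>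
        exp (Digamma (y + 1)) > (y + 1) * (y / (y + 1)) powr (1/2))
   \<and> (\<forall>y :: real. y > 1 \<longrightarrow>
        ((\<lambda>x. gamma_ratio x y) \<longlongrightarrow> y * exp (- Digamma (y + 1))) (at (-1)) \<and>
        ((\<lambda>x. ratio_bound (1/2) x y) \<longlongrightarrow> ((y - 1) / y) powr (1/2)) (at (-1)) \<and>
        exp (- Digamma (y + 1)) > 1 / y * ((y - 1) / y) powr (1/2))
   \<and> (\<forall>\<alpha> > 1/2. \<not> (\<forall>x y :: real. x > 1 \<and> y > -1 \<and> x + y > 0 \<longrightarrow>
        gamma_ratio x y < ratio_bound \<alpha> x y))
   \<and> (\<forall>\<alpha> < 1/2. \<not> (\<forall>x y :: real. x < 1 \<and> x \<noteq> 0 \<and> x \<noteq> -1 \<and> y > -1 \<and> x + y > 0 \<longrightarrow>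
        gamma_ratio x y > ratio_bound \<alpha> x y))
   \<and> (\<forall>\<alpha> < 1/2. \<not> (\<forall>y :: real. y > 0 \<longrightarrow>
        exp (Digamma (y + 1)) > (y + 1) * (y / (y + 1)) powr \<alpha>))
   \<and> (\<forall>\<alpha> < 1/2. \<not> (\<forall>y :: real. y > 1 \<longrightarrow>
        exp (- Digamma (y + 1)) > 1 / y * ((y - 1) / y) powr \<alpha>))"
proof (intro conjI allI impI, goal_cases)
  case (1 x y)
  then show ?case by (intro gamma_ratio_less_ratio_bound) auto
next
  case (2 x y)
  then show ?case by (intro gamma_ratio_greater_ratio_bound) auto
next
  case (3 y)
  then show ?case by (rule gamma_ratio_tendsto_at_0)
next
  case (4 y)
  then show ?case using ratio_bound_isCont[of 0 y "1/2"] by (simp add: isCont_def ratio_bound_def)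
next
  case (5 y)
  then show ?case using Digamma_gt_ln[of y] by (subst exp_Digamma_gt_iff) auto
next
  case (6 y)
  then show ?case by (rule gamma_ratio_tendsto_at_minus_1)
next
  case (7 y)
  then show ?case using ratio_bound_isCont[of "-1" y "1/2"] by (simp add: isCont_def ratio_bound_def)
next
  case (8 y)
  then show ?case using Digamma_lt_ln[of y] by (subst exp_minus_Digamma_gt_iff) auto
next
  \<comment> \<open>The slice \<open>y = 0\<close> already refutes a wrong power in both main
    inequalities.\<close>
  case (9 \<alpha>)
  then show ?case using power_optimal_right_of_1[of \<alpha>] by force
next
  case (10 \<alpha>)
  then show ?case using power_optimal_left_of_1[of \<alpha>] by force
next
  case (11 \<alpha>)
  then show ?case using power_optimal_Digamma_gt[of \<alpha>] exp_Digamma_gt_iff[of _ \<alpha>] by (meson not_le)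
next
  case (12 \<alpha>)
  then show ?case using power_optimal_Digamma_lt[of \<alpha>] exp_minus_Digamma_gt_iff[of _ \<alpha>] by (meson not_le)
qed

end
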